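(* (Newton identities.) For any $n\times n$ $q$-Manin matrix $M$ over $\mathfrak R$ and any integer $m\ge0$, $$m\,\mathfrak e_m=\sum_{k=0}^{m-1}(-1)^{m+k+1}\,\mathfrak e_k\,\mathrm{tr}\big(M^{[m-k]}\big),$$ where $\mathfrak e_m=0$ for $m>n$.
   Context: Let $q$ be a nonzero complex number and $\mathfrak R$ an associative unital, not necessarily commutative, algebra over $\mathbb C$. A matrix $M=(M_{ij})$ over $\mathfrak R$ is called $q$-Manin if $M_{ij}M_{kj}=q^{-1}M_{kj}M_{ij}$ for all $j$ and all $i<k$, and $M_{ij}M_{kl}-M_{kl}M_{ij}=q^{-1}M_{kj}M_{il}-q\,M_{il}M_{kj}$ for all $i<k$, $j<l$. The $q$-determinant of an $m\times m$ matrix $N$ is $\det_q N=\sum_{\tau\in\mathfrak S_m}(-q)^{-\mathrm{inv}(\tau)}N_{\tau(1)1}\cdots N_{\tau(m)m}$, where $\mathrm{inv}(\tau)$ is the number of inversions. Set $\mathfrak e_0=1$ and $\mathfrak e_m=\sum_{1\le i_1<\ldots<i_m\le n}\det_q\big((M_{i_ai_b})_{1\le a,b\le m}\big)$ for $1\le m\le n$. For $n\times n$ matrices $A,B$ over $\mathfrak R$ define $A*_qB$ by $(A*_qB)_{ik}=\sum_{j=1}^n q^{\mathrm{sgn}(j-i)}A_{ij}B_{jk}$, where $\mathrm{sgn}(r)=1,0,-1$ for $r>0$, $r=0$, $r<0$. The $q$-powers of $M$ are $M^{[0]}=1$ (identity matrix) and $M^{[m]}=M^{[m-1]}*_qM$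 for $m\ge1$. $\mathrm{tr}$ is the sum of the diagonal entries. *)

theory Defs
  imports
    Complex_Main
    "HOL-Combinatorics.Permutations"
    "Jordan_Normal_Form.DL_Submatrix"
begin

(* Associative unital algebras over the complex numbers, in the style of the class real_algebra_1.
   The superclasses are ring and monoid_mult rather than ring_1, so that the zero algebra
   (where 0 = 1) is not excluded. *)
class complex_algebra = ring + monoid_mult +
  fixes scaleC :: "complex \<Rightarrow> 'a \<Rightarrow> 'a" (infixr "*\<^sub>C" 75)
  assumes scaleC_add_right: "a *\<^sub>C (x + y) = a *\<^sub>C x + a *\<^sub>C y"
    and scaleC_add_left: "(a + b) *\<^sub>C x = a *\<^sub>C x + b *\<^sub>C x"
    and scaleC_scaleC: "a *\<^sub>C b *\<^sub>C x = (a * b) *\<^sub>C x"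
    and scaleC_one: "1 *\<^sub>C x = x"
    and mult_scaleC_left: "(a *\<^sub>C x) * y = a *\<^sub>C (x * y)"
    and mult_scaleC_right: "x * (a *\<^sub>C y) = a *\<^sub>C (x * y)"

(* Matrix indices are 0-based. The relations depend on the indices only through their order,
   so they are unaffected by the shift from {1..n}. *)
definition q_manin :: "complex \<Rightarrow> 'a::complex_algebra mat \<Rightarrow> bool" where
  "q_manin q M \<longleftrightarrow>
     (\<forall>i k j. i < k \<and> k < dim_row M \<and> j < dim_col M \<longrightarrow>
        M $$ (i,j) * M $$ (k,j) = inverse q *\<^sub>C (M $$ (k,j) * M $$ (i,j))) \<and>
     (\<forall>i k j l. i < k \<and> k < dim_row M \<and> j < l \<and> l < dim_col M \<longrightarrow>
        M $$ (i,j) * M $$ (k,l) - M $$ (k,l) * M $$ (i,j) =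
        inverse q *\<^sub>C (M $$ (k,j) * M $$ (i,l)) - q *\<^sub>C (M $$ (i,l) * M $$ (k,j)))"

definition inversions :: "nat \<Rightarrow> (nat \<Rightarrow> nat) \<Rightarrow> nat" where
  "inversions m \<tau> = card {(a, b). a < b \<and> b < m \<and> \<tau> b < \<tau> a}"

(* The factors do not commute; prod_list multiplies them in increasing order of the columns. *)
definition q_det :: "complex \<Rightarrow> 'a::complex_algebra mat \<Rightarrow> 'a" where
  "q_det q N = (let m = dim_row N in
     \<Sum>\<tau> | \<tau> permutes {..<m}.
       ((- q) powi (- int (inversions m \<tau>))) *\<^sub>C prod_list (map (\<lambda>j. N $$ (\<tau> j, j)) [0..<m]))"

(* Increasing sequences i_1 < ... < i_m of indices are represented by their sets of entries.
   The conventions e_0 = 1 and e_m = 0 for m > n are the lemmas q_elem_0 and q_elem_eq_0. *)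
definition q_elem :: "complex \<Rightarrow> 'a::complex_algebra mat \<Rightarrow> nat \<Rightarrow> 'a" where
  "q_elem q M m = (\<Sum>I | I \<subseteq> {..<dim_row M} \<and> card I = m. q_det q (submatrix M I I))"

definition q_times :: "complex \<Rightarrow> 'a::complex_algebra mat \<Rightarrow> 'a mat \<Rightarrow> 'a mat" where
  "q_times q A B = mat (dim_row A) (dim_col B)
     (\<lambda>(i,k). \<Sum>j<dim_row B. (q powi sgn (int j - int i)) *\<^sub>C (A $$ (i,j) * B $$ (j,k)))"

primrec q_power :: "complex \<Rightarrow> 'a::complex_algebra mat \<Rightarrow> nat \<Rightarrow> 'a mat" where
  "q_power q M 0 = 1\<^sub>m (dim_row M)"
| "q_power q M (Suc m) = q_times q (q_power q M m) M"

definition tr :: "'a::comm_monoid_add mat \<Rightarrow> 'a" where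
  "tr A = (\<Sum>i<dim_row A. A $$ (i,i))"

lemma q_det_0:
  assumes "dim_row N = 0"
  shows "q_det q N = 1"
proof -
  have "{\<tau>. \<tau> permutes {..<0::nat}} = {id}"
    by simp
  moreover have "inversions 0 id = 0"
    by (simp add: inversions_def)
  ultimately show ?thesis
    by (simp add: q_det_def assms scaleC_one)
qed

lemma q_elem_0: "q_elem q M 0 = 1"
proof -
  have "I = {}" if "I \<subseteq> {..<dim_row M}" "card I = 0" for I
    using finite_subset[OF that(1) finite_lessThan] that(2) by (simp only: card_0_eq)
  then have "{I. I \<subseteq> {..<dim_row M} \<and> card I = 0} = {{}}"
    using card.empty by blast
  moreover have "dim_row (submatrix M {} {}) = 0"
    by (simp add: dim_submatrix)
  ultimately show ?thesis
    by (simp only: q_elem_def sum.insert finite.emptyI empty_iff sum.empty q_det_0 add_0_right not_False_eq_True)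
qed

lemma q_elem_eq_0:
  assumes "m > dim_row M"
  shows "q_elem q M m = 0"
proof -
  have "card I \<le> dim_row M" if "I \<subseteq> {..<dim_row M}" for I
    using card_mono[OF finite_lessThan that] by (simp only: card_lessThan)
  then have "\<not> (I \<subseteq> {..<dim_row M} \<and> card I = m)" for I
    using assms leD by blast
  then have "{I. I \<subseteq> {..<dim_row M} \<and> card I = m} = {}"
    by (simp only: empty_def)
  then show ?thesis
    by (simp only: q_elem_def sum.empty)
qed

end

theory Submission
  imports Defs "HOL-Combinatorics.Multiset_Permutations"
begin

text \<open>
  The proof takes place in the \<open>q\<close>-exterior algebra. Its generators commute with the entries of \<open>M\<close>
  and satisfy \<open>\<psi>\<^sub>i \<psi>\<^sub>i = 0\<close> and \<open>\<psi>\<^sub>k \<psi>\<^sub>i = - q\<^sup>-\<^sup>1 \<psi>\<^sub>i \<psi>\<^sub>k\<close> for \<open>i < k\<close>; the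
  sorted monomials \<open>\<psi>\<^sub>K\<close> form a basis. The defining relations of a \<open>q\<close>-Manin matrix say that the
  elements \<open>\<phi>\<^sub>j = \<Sum>i. \<psi>\<^sub>i M\<^sub>i\<^sub>j\<close> satisfy the same relations as the generators
  (\<open>wedge_column_square\<close>, \<open>wedge_column_commute\<close>). Hence products of \<open>\<phi>\<^sub>j\<close> and products of \<open>\<psi>\<^sub>j\<close>
  are sorted with the same factors (\<open>wedge_column_wedge\<close>), while the coefficient of \<open>\<psi>\<^sub>I\<close> in
  \<open>\<phi>\<^sub>I\<close> is the principal \<open>q\<close>-minor on \<open>I\<close> (\<open>q_det_submatrix\<close>). An element of the algebra is
  represented by its coefficient function, and the only operation on it is right multiplication by
  some \<open>\<phi>\<^sub>j\<close>.

  Let \<open>D\<^sub>m(i,j)\<close> (\<open>q_cofactor\<close>) be the sum over all \<open>I\<close> of size \<open>m\<close> with \<open>i \<notin> I\<close> of the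
  coefficient of \<open>\<psi>\<^sub>I \<psi>\<^sub>i\<close> in \<open>\<phi>\<^sub>I \<psi>\<^sub>j\<close>. Multiplying by \<open>M\<^sub>l\<^sub>j\<close> and summing over \<open>l\<close>
  turns \<open>\<phi>\<^sub>I \<psi>\<^sub>l\<close> into \<open>\<phi>\<^sub>I \<phi>\<^sub>j\<close>, which is again sorted. This yields the recursion
  \<open>q\<^sup>s D\<^sub>m\<^sub>+\<^sub>1(i,j) = \<delta>\<^sub>i\<^sub>j e\<^sub>m\<^sub>+\<^sub>1 - (\<Sum>l. D\<^sub>m(i,l) M\<^sub>l\<^sub>j)\<close> with \<open>s = sgn (i - j)\<close>
  (\<open>q_cofactor_Suc\<close>). The powers of \<open>q\<close> in the product \<open>q_times\<close> cancel \<open>q\<^sup>s\<close>, so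
  \<open>q\<^sup>s D\<^sub>m(i,j)\<close> is the entry at \<open>(i,j)\<close> of \<open>\<Sum>k\<le>m. (-1)\<^sup>m\<^sup>-\<^sup>k e\<^sub>k M\<^sup>[\<^sup>m\<^sup>-\<^sup>k\<^sup>]\<close>
  (\<open>q_cayley_hamilton\<close>).

  It remains to take the trace. On the diagonal \<open>D\<^sub>m(i,i)\<close> is the sum of the principal minors of size
  \<open>m\<close> that avoid \<open>i\<close>, so its sum over \<open>i\<close> is \<open>(n - m) e\<^sub>m\<close>. The term \<open>k = m\<close> on the other side
  is \<open>n e\<^sub>m\<close>, and the difference is the identity of Newton.
\<close>

section \<open>The \<open>q\<close>-exterior algebra\<close>

interpretation scaleC: vector_space "scaleC :: complex \<Rightarrow> 'a::complex_algebra \<Rightarrow> 'a"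
  by unfold_locales
    (simp_all add: scaleC_add_right scaleC_add_left scaleC_scaleC scaleC_one)

text \<open>
  For \<open>i \<notin> K\<close>, the factor by which \<open>\<psi>\<^sub>K \<psi>\<^sub>i\<close> differs from the sorted monomial with support
  \<open>insert i K\<close>: \<open>\<psi>\<^sub>i\<close> passes every larger generator of \<open>K\<close>, at the price of \<open>- inverse q\<close> each.
\<close>

definition weight :: "complex \<Rightarrow> nat \<Rightarrow> nat set \<Rightarrow> complex" where
  "weight q i K = (- inverse q) ^ card {a\<in>K. i < a}"

lemma weight_nonzero: "q \<noteq> 0 \<Longrightarrow> weight q i K \<noteq> 0"
  by (simp add: weight_def)

lemma weight_insert_self: "weight q i (insert i K) = weight q i K"
proof -
  have "{a\<in>insert i K. i < a} = {a\<in>K. i < a}" by auto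
  then show ?thesis by (simp add: weight_def)
qed

lemma weight_insert:
  assumes "finite K" "a \<notin> K"
  shows "weight q i (insert a K) = (if i < a then - inverse q else 1) * weight q i K"
proof -
  have "{b\<in>insert a K. i < b} = (if i < a then insert a {b\<in>K. i < b} else {b\<in>K. i < b})"
    by auto
  then show ?thesis using assms by (simp add: weight_def)
qed

lemma weight_above:
  assumes "\<And>a. a \<in> K \<Longrightarrow> a \<le> i"
  shows "weight q i K = 1"
proof -
  have "{a\<in>K. i < a} = {}" using assms by (auto simp: not_less)
  then show ?thesis by (simp only: weight_def card.empty power_0)
qed

text \<open>
  A function \<open>v\<close> stands for the element \<open>\<Sum>K. \<psi>\<^sub>K v(K)\<close> of the \<open>q\<close>-exterior algebra with
  coefficients in the algebra of the entries, and the operation is right multiplication by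
  \<open>\<phi>\<^sub>j = \<Sum>i. \<psi>\<^sub>i M\<^sub>i\<^sub>j\<close>. Coefficients outside the index range are set to \<open>0\<close>, so that
  the relations between the \<open>\<phi>\<^sub>j\<close> become equations between functions.
\<close>

definition wedge_column ::
  "complex \<Rightarrow> 'a::complex_algebra mat \<Rightarrow> nat \<Rightarrow> (nat set \<Rightarrow> 'a) \<Rightarrow> nat set \<Rightarrow> 'a" where
  "wedge_column q M j v K =
     (if K \<subseteq> {..<dim_row M} then \<Sum>i\<in>K. weight q i K *\<^sub>C (v (K - {i}) * M $$ (i,j)) else 0)"

lemma wedge_column_scaleC:
  "wedge_column q M j (\<lambda>K. c *\<^sub>C v K) = (\<lambda>K. c *\<^sub>C wedge_column q M j v K)"
  by (auto simp: wedge_column_def fun_eq_iff scaleC.scale_sum_right mult_scaleC_left mult.commute)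

lemma wedge_column_zero: "wedge_column q M j (\<lambda>K. 0) = (\<lambda>K. 0)"
  by (simp add: wedge_column_def fun_eq_iff)

text \<open>
  Removing \<open>b\<close> and then \<open>a\<close> from \<open>K\<close> leaves the same set as removing them in the other order, and
  the weights of the two orders differ by one factor \<open>- inverse q\<close>. Collecting both orders under the
  pair \<open>a < b\<close> leaves a \<open>q\<close>-minor of size two as the coefficient, and so reduces the relations
  between the \<open>\<phi>\<^sub>j\<close> to relations between such minors.
\<close>

lemma wedge_column_twice:
  assumes K: "K \<subseteq> {..<dim_row M}"
  shows "wedge_column q M j (wedge_column q M l v) K =
    (\<Sum>b\<in>K. \<Sum>a\<in>{a\<in>K. a < b}. (weight q b K * weight q a (K - {b})) *\<^sub>C
       (v (K - {a,b}) * (M $$ (a,l) * M $$ (b,j) - inverse q *\<^sub>C (M $$ (b,l) * M $$ (a,j)))))"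
proof -
  have fin: "finite K" using K finite_subset by blast
  define t where "t a b = (weight q b K * weight q a (K - {b})) *\<^sub>C
     (v (K - {a,b}) * (M $$ (a,l) * M $$ (b,j)))" for a b
  define w where "w a b = (weight q b K * weight q a (K - {b})) *\<^sub>C
     (v (K - {a,b}) * (- inverse q *\<^sub>C (M $$ (b,l) * M $$ (a,j))))" for a b
  \<comment> \<open>Here \<open>t a b\<close> is the contribution of removing \<open>b\<close> first and \<open>a\<close> second. For \<open>a < b\<close>, the
    opposite order is rewritten with the weights of \<open>t a b\<close>.\<close>
  have swap: "t b a = w a b" if "a \<in> K" "b \<in> K" "a < b" for a b
  proof -
    define L where "L = K - {a,b}"
    have L: "finite L" "a \<notin> L" "b \<notin> L"
      and K: "K = insert a (insert b L)" "K - {b} = insert a L" "K - {a} = insert b L"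
      using that fin by (auto simp: L_def)
    have "weight q a K = - inverse q * weight q a L" "weight q b K = weight q b L"
      unfolding K(1) using L that by (simp_all add: weight_insert_self weight_insert)
    then have "weight q a K * weight q b (K - {a}) =
        (weight q b K * weight q a (K - {b})) * - inverse q"
      unfolding K(2,3) by (simp add: weight_insert_self)
    then show ?thesis unfolding t_def w_def
      by (simp only: mult_scaleC_right scaleC_scaleC insert_commute[of b a])
  qed
  have "wedge_column q M j (wedge_column q M l v) K =
    (\<Sum>b\<in>K. \<Sum>a\<in>K - {b}. t a b)"
  proof -
    have "K - {b} - {a} = K - {a,b}" for a b by auto
    moreover have "K - {b} \<subseteq> {..<dim_row M}" for b using K by auto
    ultimately show ?thesis using K
      by (simp add: wedge_column_def t_def sum_distrib_right scaleC.scale_sum_right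
          mult_scaleC_left mult.assoc)
  qed
  also have "\<dots> = (\<Sum>b\<in>K. (\<Sum>a\<in>{a\<in>K. a < b}. t a b) + (\<Sum>a\<in>{a\<in>K. b < a}. t a b))"
  proof (rule sum.cong[OF refl])
    fix b assume "b \<in> K"
    have split: "K - {b} = {a\<in>K. a < b} \<union> {a\<in>K. b < a}" by auto
    show "(\<Sum>a\<in>K - {b}. t a b) =
        (\<Sum>a\<in>{a\<in>K. a < b}. t a b) + (\<Sum>a\<in>{a\<in>K. b < a}. t a b)"
      unfolding split by (rule sum.union_disjoint) (use fin in auto)
  qed
  also have "\<dots> = (\<Sum>b\<in>K. \<Sum>a\<in>{a\<in>K. a < b}. t a b) + (\<Sum>b\<in>K. \<Sum>a\<in>{a\<in>K. b < a}. t a b)"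
    by (simp add: sum.distrib)
  also have "(\<Sum>b\<in>K. \<Sum>a\<in>{a\<in>K. b < a}. t a b) = (\<Sum>a\<in>K. \<Sum>b\<in>{b\<in>K. b < a}. t a b)"
    by (rule sum.swap_restrict) (use fin in auto)
  also have "\<dots> = (\<Sum>b\<in>K. \<Sum>a\<in>{a\<in>K. a < b}. w a b)"
    by (intro sum.cong refl) (auto simp: swap)
  finally show ?thesis
    by (simp add: sum.distrib[symmetric] t_def w_def scaleC.scale_right_diff_distrib 
        right_diff_distrib sum_subtractf scaleC.scale_minus_left sum_negf)
qed

text \<open>
  For \<open>l = j\<close> the minor of size two vanishes: this is the relation within one column of a
  \<open>q\<close>-Manin matrix.
\<close>

lemma wedge_column_square:
  assumes "q_manin q M" "j < dim_col M"
  shows "wedge_column q M j (wedge_column q M j v) = (\<lambda>K. 0)"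
proof
  fix K
  show "wedge_column q M j (wedge_column q M j v) K = 0"
  proof (cases "K \<subseteq> {..<dim_row M}")
    case True
    have "M $$ (a,j) * M $$ (b,j) = inverse q *\<^sub>C (M $$ (b,j) * M $$ (a,j))"
      if "a < b" "b \<in> K" for a b
      using assms that True unfolding q_manin_def by blast
    then show ?thesis unfolding wedge_column_twice[OF True]
      by (auto intro!: sum.neutral)
  qed (simp add: wedge_column_def)
qed

text \<open>
  The relation across two columns of a \<open>q\<close>-Manin matrix says that exchanging the columns of a minor
  of size two multiplies it by \<open>- inverse q\<close>. So the \<open>\<phi>\<^sub>j\<close> satisfy the same relations as the
  generators \<open>\<psi>\<^sub>j\<close>.
\<close>

lemma wedge_column_commute:
  assumes q: "q \<noteq> 0" and "q_manin q M" "j < l" "l < dim_col M"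
  shows "wedge_column q M j (wedge_column q M l v) =
    (\<lambda>K. - inverse q *\<^sub>C wedge_column q M l (wedge_column q M j v) K)"
proof
  fix K
  show "wedge_column q M j (wedge_column q M l v) K =
     - inverse q *\<^sub>C wedge_column q M l (wedge_column q M j v) K"
  proof (cases "K \<subseteq> {..<dim_row M}")
    case True
    have rel: "M $$ (a,l) * M $$ (b,j) - inverse q *\<^sub>C (M $$ (b,l) * M $$ (a,j)) =
        - inverse q *\<^sub>C (M $$ (a,j) * M $$ (b,l) - inverse q *\<^sub>C (M $$ (b,j) * M $$ (a,l)))"
      if "a < b" "b \<in> K" for a b
    proof -
      have r: "M $$ (a,j) * M $$ (b,l) - M $$ (b,l) * M $$ (a,j) =
        inverse q *\<^sub>C (M $$ (b,j) * M $$ (a,l)) - q *\<^sub>C (M $$ (a,l) * M $$ (b,j))"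
        using assms that True unfolding q_manin_def by blast
      have "M $$ (a,j) * M $$ (b,l) - inverse q *\<^sub>C (M $$ (b,j) * M $$ (a,l)) = 
        M $$ (b,l) * M $$ (a,j) - q *\<^sub>C (M $$ (a,l) * M $$ (b,j))"
        using r by (simp add: algebra_simps)
      then show ?thesis using q
        by (simp add: scaleC.scale_right_diff_distrib scaleC.scale_minus_left)
    qed
    have eq: "v (K - {a,b}) * (M $$ (a,l) * M $$ (b,j) - inverse q *\<^sub>C (M $$ (b,l) * M $$ (a,j))) =
        - inverse q *\<^sub>C (v (K - {a,b}) * (M $$ (a,j) * M $$ (b,l) - inverse q *\<^sub>C (M $$ (b,j) * M $$ (a,l))))"
      if "a < b" "b \<in> K" for a b
      by (simp only: rel[OF that] mult_scaleC_right)
    show ?thesis unfolding wedge_column_twice[OF True] scaleC.scale_sum_right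
      by (intro sum.cong refl, subst eq) (auto simp: mult_ac)
  qed (simp add: wedge_column_def)
qed

text \<open>
  The product of the \<open>\<phi>\<^sub>j\<close> in the order of the list, starting from the unit \<open>\<psi>\<^sub>{\<^sub>}\<close>. Along the
  sorted list of \<open>J\<close> it is the element \<open>\<phi>\<^sub>J\<close>, for which \<open>wedge q M J\<close> is an abbreviation.
\<close>

definition wedge_columns :: "complex \<Rightarrow> 'a::complex_algebra mat \<Rightarrow> nat list \<Rightarrow> nat set \<Rightarrow> 'a" where
  "wedge_columns q M js = fold (wedge_column q M) js (\<lambda>K. if K = {} then 1 else 0)"

abbreviation wedge :: "complex \<Rightarrow> 'a::complex_algebra mat \<Rightarrow> nat set \<Rightarrow> nat set \<Rightarrow> 'a" where
  "wedge q M J \<equiv> wedge_columns q M (sorted_list_of_set J)"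

lemma wedge_insert_max:
  assumes "finite J" "\<And>a. a \<in> J \<Longrightarrow> a < b"
  shows "wedge q M (insert b J) = wedge_column q M b (wedge q M J)"
proof -
  have "sorted (sorted_list_of_set J @ [b])" "distinct (sorted_list_of_set J @ [b])"
    using assms by (auto simp: sorted_append less_imp_le)
  from sorted_list_of_set.idem_if_sorted_distinct[OF this]
  have "sorted_list_of_set (insert b J) = sorted_list_of_set J @ [b]"
    using assms(1) by simp
  then show ?thesis by (simp add: wedge_columns_def)
qed

text \<open>
  \<open>\<phi>\<^sub>J \<phi>\<^sub>j\<close> is sorted with the same weight as \<open>\<psi>\<^sub>J \<psi>\<^sub>j\<close>, since the sorting uses only the
  relations that \<open>\<phi>\<close> and \<open>\<psi>\<close> share.
\<close>

lemma wedge_column_wedge: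
  assumes q: "q \<noteq> 0" and M: "q_manin q M" and "finite J" and "J \<subseteq> {..<dim_col M}" "j < dim_col M"
  shows "wedge_column q M j (wedge q M J) =
    (if j \<in> J then (\<lambda>K. 0) else (\<lambda>K. weight q j J *\<^sub>C wedge q M (insert j J) K))"
  using assms(3,4)
proof (induction J rule: finite_linorder_max_induct)
  case empty
  then show ?case
    using wedge_insert_max[of "{}" j q M] by (simp add: weight_def scaleC_one)
next
  case (insert b A)
  \<comment> \<open>Only \<open>j < b\<close> needs the induction hypothesis: move \<open>\<phi>\<^sub>j\<close> past the last factor
    \<open>\<phi>\<^sub>b\<close> and insert it into the rest.\<close>
  have split: "wedge q M (insert b A) = wedge_column q M b (wedge q M A)"
    using insert by (intro wedge_insert_max) auto
  consider "b < j" | "b = j" | "j < b" by linarith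
  then show ?case
  proof cases
    case 1
    have le: "a < j" if "a \<in> insert b A" for a using that insert.hyps 1 by auto
    then have "j \<notin> insert b A" by blast
    moreover have "wedge q M (insert j (insert b A)) = wedge_column q M j (wedge q M (insert b A))"
      using insert.hyps le by (intro wedge_insert_max) auto
    moreover have "weight q j (insert b A) = 1"
      using le by (intro weight_above) (auto intro: less_imp_le)
    ultimately show ?thesis by (simp add: scaleC_one)
  next
    case 2
    then show ?thesis unfolding split
      using wedge_column_square[OF M assms(5)] by simp
  next
    case 3
    have IH: "wedge_column q M j (wedge q M A) =
      (if j \<in> A then (\<lambda>K. 0) else (\<lambda>K. weight q j A *\<^sub>C wedge q M (insert j A) K))"
      using insert by auto
    have eq: "wedge_column q M j (wedge q M (insert b A)) =
      (\<lambda>K. - inverse q *\<^sub>C wedge_column q M b (wedge_column q M j (wedge q M A)) K)"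
      unfolding split using 3 insert.prems by (intro wedge_column_commute[OF q M]) auto
    show ?thesis
    proof (cases "j \<in> A")
      case True
      then show ?thesis unfolding eq IH by (simp add: wedge_column_zero)
    next
      case False
      have "wedge q M (insert b (insert j A)) = wedge_column q M b (wedge q M (insert j A))"
        using insert.hyps 3 by (intro wedge_insert_max) auto
      moreover have "weight q j (insert b A) = - inverse q * weight q j A"
        using insert.hyps 3 by (subst weight_insert) auto
      ultimately show ?thesis unfolding eq IH using False 3
        by (simp add: wedge_column_scaleC insert_commute[of j b])
    qed
  qed
qed

section \<open>Principal minors as coefficients\<close>

lemma inversions_snoc:
  assumes "distinct ys"
  shows "inversions (Suc (length ys)) (nth (ys @ [i])) =
    inversions (length ys) (nth ys) + card {a\<in>set ys. i < a}"
proof -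
  define m where "m = length ys"
  define A where "A = {(a, b). a < b \<and> b < m \<and> ys ! b < ys ! a}"
  define B where "B = {a. a < m \<and> i < ys ! a}"
  have "{(a, b). a < b \<and> b < Suc m \<and> (ys @ [i]) ! b < (ys @ [i]) ! a} = A \<union> (\<lambda>a. (a, m)) ` B"
    unfolding A_def B_def m_def by (auto simp: nth_append less_Suc_eq)
  moreover have "finite A"
    by (rule finite_subset[of _ "{..<m} \<times> {..<m}"]) (auto simp: A_def)
  moreover have "card ((\<lambda>a. (a, m)) ` B) = card B"
    by (intro card_image inj_onI) auto
  moreover have "card B = card {a\<in>set ys. i < a}"
  proof -
    have "{a\<in>set ys. i < a} = nth ys ` B"
      by (auto simp: B_def m_def in_set_conv_nth)
    moreover have "inj_on (nth ys) B"
      using assms by (auto intro!: inj_onI simp: B_def m_def nth_eq_iff_index_eq)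
    ultimately show ?thesis by (simp add: card_image)
  qed
  moreover have "card (A \<union> (\<lambda>a. (a, m)) ` B) = card A + card ((\<lambda>a. (a, m)) ` B)"
    using \<open>finite A\<close> by (intro card_Un_disjoint) (auto simp: A_def B_def)
  ultimately show ?thesis
    by (simp add: inversions_def m_def[symmetric] A_def)
qed

text \<open>
  Grouping the arrangements of \<open>K\<close> by their last entry matches the action of
  \<open>wedge_column\<close>, which splits off the last factor.
\<close>

lemma permutations_of_set_snoc:
  "bij_betw (\<lambda>(i, ys). ys @ [i]) (SIGMA i:K. permutations_of_set (K - {i}))
    (permutations_of_set K - {[]})"
proof (rule bij_betwI[where g = "\<lambda>zs. (last zs, butlast zs)"])
  show "(\<lambda>(i, ys). ys @ [i]) \<in> (SIGMA i:K. permutations_of_set (K - {i})) \<rightarrow>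
    permutations_of_set K - {[]}"
  proof (rule funcsetI, clarify)
    fix i ys assume "i \<in> K" "ys \<in> permutations_of_set (K - {i})"
    then have "set (ys @ [i]) = K" "distinct (ys @ [i])"
      by (auto dest: permutations_of_setD)
    then show "ys @ [i] \<in> permutations_of_set K - {[]}"
      by blast
  qed
  show "(\<lambda>zs. (last zs, butlast zs)) \<in> permutations_of_set K - {[]} \<rightarrow>
    (SIGMA i:K. permutations_of_set (K - {i}))"
  proof
    fix zs assume "zs \<in> permutations_of_set K - {[]}"
    then have "zs \<noteq> []" "set zs = K" "distinct zs"
      by (auto dest: permutations_of_setD)
    moreover from this obtain ys i where "zs = ys @ [i]"
      by (cases zs rule: rev_cases) auto
    ultimately show "(last zs, butlast zs) \<in> (SIGMA i:K. permutations_of_set (K - {i}))"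
      by (auto simp: permutations_of_set_def)
  qed
qed auto

text \<open>
  The Leibniz expansion of a product of columns. Appending \<open>i\<close> to an arrangement adds one inversion
  for every larger entry before it, which is the exponent in \<open>weight q i K\<close>.
\<close>

lemma wedge_columns_eq_sum:
  assumes "K \<subseteq> {..<dim_row M}" "card K = length js"
  shows "wedge_columns q M js K =
    (\<Sum>ys\<in>permutations_of_set K. (- inverse q) ^ inversions (length js) (nth ys) *\<^sub>C
       prod_list (map (\<lambda>t. M $$ (ys ! t, js ! t)) [0..<length js]))"
  using assms
proof (induction js arbitrary: K rule: rev_induct)
  case Nil
  then have "K = {}" using finite_subset by fastforce
  then show ?case by (simp add: wedge_columns_def inversions_def scaleC_one)
next
  case (snoc j js)
  have fin: "finite K" and ne: "K \<noteq> {}" using snoc.prems finite_subset by auto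
  define term_of where "term_of zs =
     (- inverse q) ^ inversions (length (js @ [j])) (nth zs) *\<^sub>C
       prod_list (map (\<lambda>t. M $$ (zs ! t, (js @ [j]) ! t)) [0..<length (js @ [j])])" for zs
  have step: "weight q i K *\<^sub>C (wedge_columns q M js (K - {i}) * M $$ (i,j)) =
      (\<Sum>ys\<in>permutations_of_set (K - {i}). term_of (ys @ [i]))" if "i \<in> K" for i
  proof -
    have "wedge_columns q M js (K - {i}) =
      (\<Sum>ys\<in>permutations_of_set (K - {i}). (- inverse q) ^ inversions (length js) (nth ys) *\<^sub>C
         prod_list (map (\<lambda>t. M $$ (ys ! t, js ! t)) [0..<length js]))"
      using snoc.prems that fin by (intro snoc.IH) auto
    moreover have "term_of (ys @ [i]) = (weight q i K * (- inverse q) ^ inversions (length js) (nth ys)) *\<^sub>C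
        (prod_list (map (\<lambda>t. M $$ (ys ! t, js ! t)) [0..<length js]) * M $$ (i,j))"
      if ys: "ys \<in> permutations_of_set (K - {i})" for ys
    proof -
      have d: "distinct ys" and set: "set ys = K - {i}"
        using ys by (auto simp: permutations_of_set_def)
      have len: "length ys = length js"
        using distinct_card[OF d] set snoc.prems(2) \<open>i \<in> K\<close> fin by simp
      have "{a\<in>K. i < a} = {a\<in>set ys. i < a}" using set by auto
      then have "(- inverse q) ^ inversions (length (js @ [j])) (nth (ys @ [i])) =
          weight q i K * (- inverse q) ^ inversions (length js) (nth ys)"
        using inversions_snoc[OF d, of i] len by (simp add: weight_def power_add mult.commute)
      moreover have "map (\<lambda>t. M $$ ((ys @ [i]) ! t, (js @ [j]) ! t)) [0..<length (js @ [j])] =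
          map (\<lambda>t. M $$ (ys ! t, js ! t)) [0..<length js] @ [M $$ (i,j)]"
        using len by (auto simp: nth_append)
      ultimately show ?thesis unfolding term_of_def
        by (simp only: prod_list.append prod_list.Cons prod_list.Nil mult_1_right)
    qed
    ultimately show ?thesis
      by (simp add: sum_distrib_right scaleC.scale_sum_right mult_scaleC_left)
  qed
  have "wedge_columns q M (js @ [j]) K = (\<Sum>i\<in>K. weight q i K *\<^sub>C (wedge_columns q M js (K - {i}) * M $$ (i,j)))"
    using snoc.prems(1) by (simp add: wedge_columns_def wedge_column_def)
  also have "\<dots> = (\<Sum>i\<in>K. \<Sum>ys\<in>permutations_of_set (K - {i}). term_of (ys @ [i]))"
    by (intro sum.cong refl step)
  also have "\<dots> = (\<Sum>(i, ys)\<in>(SIGMA i:K. permutations_of_set (K - {i})). term_of (ys @ [i]))"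
    using fin by (subst sum.Sigma) auto
  also have "\<dots> = sum term_of (permutations_of_set K - {[]})"
    by (subst sum.reindex_bij_betw[OF permutations_of_set_snoc, symmetric])
      (simp add: case_prod_unfold)
  also have "permutations_of_set K - {[]} = permutations_of_set K"
    using ne by (auto simp: permutations_of_set_def)
  finally show ?case by (simp only: term_of_def)
qed

lemma nth_sorted_list_of_set_less_iff:
  fixes I :: "nat set"
  assumes "a < card I" "b < card I"
  shows "sorted_list_of_set I ! a < sorted_list_of_set I ! b \<longleftrightarrow> a < b"
proof -
  have *: "sorted_list_of_set I ! a < sorted_list_of_set I ! b" if "a < b" "b < card I" for a b
    by (rule sorted_wrt_nth_less[OF _ that(1)]) (use that in auto)
  show ?thesis using *[of a b] *[of b a] assms by (metis less_asym nat_neq_iff)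
qed

text \<open>
  \<open>submatrix\<close> enumerates its index set by \<open>pick\<close>, whereas the products \<open>\<phi>\<^sub>I\<close> are taken along the
  sorted list.
\<close>

lemma pick_eq_nth_sorted_list_of_set:
  assumes "a < card I"
  shows "pick I a = sorted_list_of_set I ! a"
proof -
  define xs where "xs = sorted_list_of_set I"
  have fin: "finite I" using assms card.infinite by fastforce
  then have set: "set xs = I" and len: "length xs = card I" and d: "distinct xs"
    by (auto simp: xs_def)
  have lt: "xs ! b < xs ! c \<longleftrightarrow> b < c" if "b < card I" "c < card I" for b c
    unfolding xs_def using nth_sorted_list_of_set_less_iff that by blast
  have "{b\<in>I. b < xs ! a} = nth xs ` {..<a}"
    using assms len lt unfolding set[symmetric]
    by (auto simp: in_set_conv_nth) (metis less_trans)
  moreover have "inj_on (nth xs) {..<a}"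
    using d assms len by (auto intro!: inj_onI simp: nth_eq_iff_index_eq)
  ultimately have "card {b\<in>I. b < xs ! a} = a" by (simp add: card_image)
  moreover have "xs ! a \<in> I" using assms len set nth_mem by metis
  ultimately show ?thesis unfolding xs_def[symmetric] using pick_card_in_set by metis
qed

lemma bij_betw_permute_list:
  assumes "distinct xs"
  shows "bij_betw (\<lambda>\<tau>. permute_list \<tau> xs) {\<tau>. \<tau> permutes {..<length xs}}
    (permutations_of_set (set xs))"
proof (rule bij_betwI')
  fix \<sigma> \<tau> assume s: "\<sigma> \<in> {\<tau>. \<tau> permutes {..<length xs}}" and t: "\<tau> \<in> {\<tau>. \<tau> permutes {..<length xs}}"
  show "permute_list \<sigma> xs = permute_list \<tau> xs \<longleftrightarrow> \<sigma> = \<tau>"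
  proof
    assume eq: "permute_list \<sigma> xs = permute_list \<tau> xs"
    show "\<sigma> = \<tau>"
    proof
      fix a
      show "\<sigma> a = \<tau> a"
      proof (cases "a < length xs")
        case True
        then have "\<sigma> a < length xs" "\<tau> a < length xs"
          using s t permutes_in_image[of _ "{..<length xs}" a] by auto
        moreover have "xs ! \<sigma> a = xs ! \<tau> a"
          using arg_cong[OF eq, of "\<lambda>ys. ys ! a"] s t True by (simp add: permute_list_nth)
        ultimately show ?thesis using assms nth_eq_iff_index_eq by blast
      next
        case False
        then show ?thesis using s t by (simp add: permutes_not_in)
      qed
    qed
  qed simp
next
  fix \<tau> assume "\<tau> \<in> {\<tau>. \<tau> permutes {..<length xs}}"
  then show "permute_list \<tau> xs \<in> permutations_of_set (set xs)"
    using assms by (auto simp: permutations_of_set_def)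
next
  fix ys assume "ys \<in> permutations_of_set (set xs)"
  then have "mset ys = mset xs"
    using assms by (metis permutations_of_setD set_eq_iff_mset_eq_distinct)
  then show "\<exists>\<tau>\<in>{\<tau>. \<tau> permutes {..<length xs}}. ys = permute_list \<tau> xs"
    by (metis mem_Collect_eq mset_eq_permutation)
qed

text \<open>
  The principal \<open>q\<close>-minor is the coefficient of \<open>\<psi>\<^sub>I\<close> in \<open>\<phi>\<^sub>I\<close>. Writing the arrangements of
  \<open>I\<close> as rearrangements of its sorted list keeps the inversions, because the list is increasing.
\<close>

lemma q_det_submatrix:
  assumes I: "I \<subseteq> {..<dim_row M}" and sq: "dim_col M = dim_row M"
  shows "q_det q (submatrix M I I) = wedge q M I I"
proof -
  define xs where "xs = sorted_list_of_set I"
  define m where "m = card I"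
  have fin: "finite I" using I finite_subset by blast
  have set: "set xs = I" and len: "length xs = m" and d: "distinct xs"
    using fin by (auto simp: xs_def m_def)
  have restr: "{i. i < dim_row M \<and> i \<in> I} = I" using I by auto
  have dim: "dim_row (submatrix M I I) = m"
    by (simp add: dim_submatrix restr m_def)
  have entry: "submatrix M I I $$ (a,b) = M $$ (xs ! a, xs ! b)" if "a < m" "b < m" for a b
    using that by (simp add: submatrix_def sq restr m_def xs_def pick_eq_nth_sorted_list_of_set)
  have "q_det q (submatrix M I I) = (\<Sum>\<tau> | \<tau> permutes {..<m}.
     (- inverse q) ^ inversions m (nth (permute_list \<tau> xs)) *\<^sub>C
       prod_list (map (\<lambda>t. M $$ (permute_list \<tau> xs ! t, xs ! t)) [0..<m]))"
    unfolding q_det_def dim Let_def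
  proof (intro sum.cong refl)
    fix \<tau> assume "\<tau> \<in> {\<tau>. \<tau> permutes {..<m}}"
    then have perm: "\<tau> permutes {..<m}" by simp
    have lt: "\<tau> a < m" if "a < m" for a
      using permutes_in_image[OF perm, of a] that by simp
    have nth: "permute_list \<tau> xs ! a = xs ! \<tau> a" if "a < m" for a
      using perm that len by (simp add: permute_list_nth)
    have "inversions m (nth (permute_list \<tau> xs)) = inversions m \<tau>"
    proof -
      have "permute_list \<tau> xs ! b < permute_list \<tau> xs ! a \<longleftrightarrow> \<tau> b < \<tau> a" if "a < m" "b < m" for a b
        using nth_sorted_list_of_set_less_iff[of "\<tau> b" I "\<tau> a"] lt that nth
        by (simp add: m_def xs_def)
      then have "{(a, b). a < b \<and> b < m \<and> permute_list \<tau> xs ! b < permute_list \<tau> xs ! a} =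
          {(a, b). a < b \<and> b < m \<and> \<tau> b < \<tau> a}"
        by (auto dest: less_trans)
      then show ?thesis by (simp add: inversions_def)
    qed
    moreover have "(- q) powi (- int k) = (- inverse q) ^ k" for k
      by (simp add: power_int_minus power_inverse[symmetric])
    moreover have "map (\<lambda>t. submatrix M I I $$ (\<tau> t, t)) [0..<m] =
        map (\<lambda>t. M $$ (permute_list \<tau> xs ! t, xs ! t)) [0..<m]"
      using lt by (auto simp: entry nth)
    ultimately show "(- q) powi (- int (inversions m \<tau>)) *\<^sub>C
        prod_list (map (\<lambda>t. submatrix M I I $$ (\<tau> t, t)) [0..<m]) =
      (- inverse q) ^ inversions m (nth (permute_list \<tau> xs)) *\<^sub>C
        prod_list (map (\<lambda>t. M $$ (permute_list \<tau> xs ! t, xs ! t)) [0..<m])"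
      by (simp only:)
  qed
  also have "\<dots> = (\<Sum>ys\<in>permutations_of_set I. (- inverse q) ^ inversions m (nth ys) *\<^sub>C
       prod_list (map (\<lambda>t. M $$ (ys ! t, xs ! t)) [0..<m]))"
    using bij_betw_permute_list[OF d] unfolding set len
    by (rule sum.reindex_bij_betw)
  also have "\<dots> = wedge q M I I"
    unfolding xs_def[symmetric] using I len by (subst wedge_columns_eq_sum) (simp_all add: m_def)
  finally show ?thesis .
qed

lemma q_elem_eq_sum_wedge:
  assumes "dim_col M = dim_row M"
  shows "q_elem q M m = (\<Sum>I | I \<subseteq> {..<dim_row M} \<and> card I = m. wedge q M I I)"
  unfolding q_elem_def using assms by (intro sum.cong refl q_det_submatrix) auto

section \<open>Cofactors and the Cayley-Hamilton expansion\<close>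

text \<open>
  The sum, over the sets \<open>I\<close> of size \<open>m\<close> without \<open>i\<close>, of the coefficient of \<open>\<psi>\<^sub>I \<psi>\<^sub>i\<close> in
  \<open>\<phi>\<^sub>I \<psi>\<^sub>j\<close>. The first weight accounts for sorting the monomial obtained by multiplying by
  \<open>\<psi>\<^sub>j\<close>, and dividing by the second one passes from the sorted monomial with support
  \<open>insert i I\<close> to \<open>\<psi>\<^sub>I \<psi>\<^sub>i\<close>.
\<close>

definition q_cofactor :: "complex \<Rightarrow> 'a::complex_algebra mat \<Rightarrow> nat \<Rightarrow> nat \<Rightarrow> nat \<Rightarrow> 'a" where
  "q_cofactor q M m i j = (\<Sum>I | I \<subseteq> {..<dim_row M} \<and> card I = m \<and> i \<notin> I.
     if j \<in> insert i I
     then (weight q j (insert i I) / weight q i (insert i I)) *\<^sub>C wedge q M I (insert i I - {j})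
     else 0)"

lemma finite_subsets_lessThan: "finite {I. I \<subseteq> {..<n::nat} \<and> P I}"
  by (rule finite_subset[of _ "Pow {..<n}"]) auto

lemma q_cofactor_diag:
  assumes "q \<noteq> 0"
  shows "q_cofactor q M m i i = (\<Sum>I | I \<subseteq> {..<dim_row M} \<and> card I = m \<and> i \<notin> I. wedge q M I I)"
  unfolding q_cofactor_def using assms
  by (intro sum.cong refl) (auto simp: weight_nonzero scaleC_one)

lemma q_cofactor_0:
  assumes "q \<noteq> 0"
  shows "q_cofactor q M 0 i j = (if i = j then 1 else 0)"
proof -
  have empty: "{I. I \<subseteq> {..<dim_row M} \<and> card I = 0 \<and> i \<notin> I} = {{}}"
    using finite_subset[of _ "{..<dim_row M}"] by (auto simp: card_eq_0_iff)
  show ?thesis unfolding q_cofactor_def empty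
    using assms by (simp add: weight_nonzero scaleC_one wedge_columns_def)
qed

text \<open>
  Since \<open>\<Sum>l. \<psi>\<^sub>l M\<^sub>l\<^sub>j = \<phi>\<^sub>j\<close>, the left side collects the coefficients of \<open>\<psi>\<^sub>I \<psi>\<^sub>i\<close> in
  \<open>\<phi>\<^sub>I \<phi>\<^sub>j\<close>, and sorting that product by \<open>wedge_column_wedge\<close> gives the right side.
\<close>

lemma sum_q_cofactor_mult:
  assumes q: "q \<noteq> 0" and M: "q_manin q M" and sq: "dim_col M = dim_row M"
    and i: "i < dim_row M" and j: "j < dim_row M"
  shows "(\<Sum>l<dim_row M. q_cofactor q M m i l * M $$ (l,j)) =
    (\<Sum>I | I \<subseteq> {..<dim_row M} \<and> card I = m \<and> i \<notin> I \<and> j \<notin> I.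
       (weight q j I / weight q i I) *\<^sub>C wedge q M (insert j I) (insert i I))"
proof -
  let ?n = "dim_row M" and ?S = "{I. I \<subseteq> {..<dim_row M} \<and> card I = m \<and> i \<notin> I}"
  have "(\<Sum>l<?n. q_cofactor q M m i l * M $$ (l,j)) =
    (\<Sum>I\<in>?S. \<Sum>l<?n. if l \<in> insert i I
       then (weight q l (insert i I) / weight q i I) *\<^sub>C (wedge q M I (insert i I - {l}) * M $$ (l,j))
       else 0)"
    unfolding q_cofactor_def sum_distrib_right
    by (subst sum.swap)
      (auto intro!: sum.cong simp: mult_scaleC_left weight_insert_self if_distrib[of "\<lambda>x. x * _"])
  also have "\<dots> = (\<Sum>I\<in>?S. (1 / weight q i I) *\<^sub>C wedge_column q M j (wedge q M I) (insert i I))"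
  proof (intro sum.cong refl)
    fix I assume "I \<in> ?S"
    then have sub: "insert i I \<subseteq> {..<?n}" using i by auto
    then have "{..<?n} \<inter> insert i I = insert i I" by auto
    then have "(\<Sum>l<?n. if l \<in> insert i I then f l else 0) = (\<Sum>l\<in>insert i I. f l)" for f :: "nat \<Rightarrow> 'a"
      by (simp only: sum.inter_restrict[symmetric] finite_lessThan)
    then show "(\<Sum>l<?n. if l \<in> insert i I
       then (weight q l (insert i I) / weight q i I) *\<^sub>C (wedge q M I (insert i I - {l}) * M $$ (l,j))
       else 0) = (1 / weight q i I) *\<^sub>C wedge_column q M j (wedge q M I) (insert i I)"
      using sub by (simp only: wedge_column_def if_True scaleC.scale_sum_right scaleC_scaleC) simp
  qed
  also have "\<dots> = (\<Sum>I\<in>?S. if j \<in> I then 0 else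
      (weight q j I / weight q i I) *\<^sub>C wedge q M (insert j I) (insert i I))"
  proof (intro sum.cong refl)
    fix I assume "I \<in> ?S"
    then have "finite I" "I \<subseteq> {..<dim_col M}" using finite_subset sq by auto
    from wedge_column_wedge[OF q M this, of j] j sq
    show "(1 / weight q i I) *\<^sub>C wedge_column q M j (wedge q M I) (insert i I) =
      (if j \<in> I then 0 else (weight q j I / weight q i I) *\<^sub>C wedge q M (insert j I) (insert i I))"
      by simp
  qed
  also have "\<dots> = (\<Sum>I\<in>?S \<inter> {I. j \<notin> I}.
      (weight q j I / weight q i I) *\<^sub>C wedge q M (insert j I) (insert i I))"
    by (subst sum.inter_restrict[OF finite_subsets_lessThan]) (auto intro!: sum.cong)
  also have "?S \<inter> {I. j \<notin> I} = {I. I \<subseteq> {..<?n} \<and> card I = m \<and> i \<notin> I \<and> j \<notin> I}"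
    by auto
  finally show ?thesis .
qed

lemma bij_betw_insert_subsets:
  assumes "j < n"
  shows "bij_betw (insert j) {I. I \<subseteq> {..<n::nat} \<and> card I = m \<and> P I \<and> j \<notin> I}
    {K. K \<subseteq> {..<n} \<and> card K = Suc m \<and> P (K - {j}) \<and> j \<in> K}"
proof (rule bij_betwI[where g = "\<lambda>K. K - {j}"])
  show "insert j \<in> {I. I \<subseteq> {..<n} \<and> card I = m \<and> P I \<and> j \<notin> I} \<rightarrow>
      {K. K \<subseteq> {..<n} \<and> card K = Suc m \<and> P (K - {j}) \<and> j \<in> K}"
    using assms finite_subset[of _ "{..<n}"] by auto
  show "(\<lambda>K. K - {j}) \<in> {K. K \<subseteq> {..<n} \<and> card K = Suc m \<and> P (K - {j}) \<and> j \<in> K} \<rightarrow>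
      {I. I \<subseteq> {..<n} \<and> card I = m \<and> P I \<and> j \<notin> I}"
    using assms finite_subset[of _ "{..<n}"] by auto
qed auto

text \<open>
  For \<open>i = j\<close> the two weights in \<open>sum_q_cofactor_mult\<close> cancel, and the sum runs over the
  principal minors whose index set contains \<open>i\<close>; the cofactor of order \<open>Suc m\<close> has the others,
  and together they make up \<open>q_elem q M (Suc m)\<close>. For \<open>i \<noteq> j\<close> a set \<open>K\<close> contributes to
  the cofactor of order \<open>Suc m\<close> only if it contains \<open>j\<close>; writing \<open>K = insert j I\<close> gives the same
  minors as in \<open>sum_q_cofactor_mult\<close>. The weights then differ by the exchange of
  \<open>\<psi>\<^sub>i\<close> and \<open>\<psi>\<^sub>j\<close>, whose factor is \<open>-1\<close> times a power of \<open>q\<close> that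
  \<open>q powi sgn (int i - int j)\<close> compensates.
\<close>

lemma q_cofactor_Suc:
  assumes q: "q \<noteq> 0" and M: "q_manin q M" and sq: "dim_col M = dim_row M"
    and i: "i < dim_row M" and j: "j < dim_row M"
  shows "q powi sgn (int i - int j) *\<^sub>C q_cofactor q M (Suc m) i j =
    (if i = j then q_elem q M (Suc m) else 0) - (\<Sum>l<dim_row M. q_cofactor q M m i l * M $$ (l,j))"
proof (cases "i = j")
  case True
  let ?T = "{K. K \<subseteq> {..<dim_row M} \<and> card K = Suc m}"
  have "(\<Sum>l<dim_row M. q_cofactor q M m i l * M $$ (l,j)) =
      (\<Sum>I | I \<subseteq> {..<dim_row M} \<and> card I = m \<and> i \<notin> I. wedge q M (insert i I) (insert i I))"
    unfolding sum_q_cofactor_mult[OF q M sq i j] using True q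
    by (auto intro!: sum.cong simp: weight_nonzero scaleC_one)
  also have "\<dots> = (\<Sum>K | K \<subseteq> {..<dim_row M} \<and> card K = Suc m \<and> i \<in> K. wedge q M K K)"
    using sum.reindex_bij_betw[OF bij_betw_insert_subsets[OF i, of m "\<lambda>_. True"], of "\<lambda>K. wedge q M K K"]
    by simp
  also have "\<dots> = (\<Sum>K\<in>?T \<inter> {K. i \<in> K}. wedge q M K K)"
    by (intro sum.cong) auto
  finally have "(\<Sum>l<dim_row M. q_cofactor q M m i l * M $$ (l,j)) = \<dots>" .
  moreover have "q_cofactor q M (Suc m) i i = (\<Sum>K\<in>?T - {K. i \<in> K}. wedge q M K K)"
    unfolding q_cofactor_diag[OF q] by (intro sum.cong) auto
  moreover have "q_elem q M (Suc m) =
      (\<Sum>K\<in>?T \<inter> {K. i \<in> K}. wedge q M K K) + (\<Sum>K\<in>?T - {K. i \<in> K}. wedge q M K K)"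
    unfolding q_elem_eq_sum_wedge[OF sq] by (rule sum.Int_Diff[OF finite_subsets_lessThan])
  ultimately show ?thesis using True by (simp add: scaleC_one)
next
  case False
  let ?T = "{K. K \<subseteq> {..<dim_row M} \<and> card K = Suc m \<and> i \<notin> K}"
  define f where "f K = (weight q j (insert i K) / weight q i (insert i K)) *\<^sub>C wedge q M K (insert i K - {j})" for K
  have "q_cofactor q M (Suc m) i j = (\<Sum>K\<in>?T \<inter> {K. j \<in> K}. f K)"
    unfolding q_cofactor_def sum.inter_restrict[OF finite_subsets_lessThan] f_def using False
    by (intro sum.cong) auto
  also have "?T \<inter> {K. j \<in> K} = {K. K \<subseteq> {..<dim_row M} \<and> card K = Suc m \<and> i \<notin> K - {j} \<and> j \<in> K}"
    using False by auto
  also have "(\<Sum>K\<in>\<dots>. f K) = (\<Sum>I | I \<subseteq> {..<dim_row M} \<and> card I = m \<and> i \<notin> I \<and> j \<notin> I. f (insert j I))"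
    by (rule sum.reindex_bij_betw[OF bij_betw_insert_subsets[OF j], symmetric])
  finally have "q powi sgn (int i - int j) *\<^sub>C q_cofactor q M (Suc m) i j =
    (\<Sum>I | I \<subseteq> {..<dim_row M} \<and> card I = m \<and> i \<notin> I \<and> j \<notin> I.
       q powi sgn (int i - int j) *\<^sub>C f (insert j I))"
    by (simp add: scaleC.scale_sum_right)
  also have "\<dots> = (\<Sum>I | I \<subseteq> {..<dim_row M} \<and> card I = m \<and> i \<notin> I \<and> j \<notin> I.
       - ((weight q j I / weight q i I) *\<^sub>C wedge q M (insert j I) (insert i I)))"
  proof (intro sum.cong refl)
    fix I assume "I \<in> {I. I \<subseteq> {..<dim_row M} \<and> card I = m \<and> i \<notin> I \<and> j \<notin> I}"
    then have I: "finite I" "i \<notin> I" "j \<notin> I" using finite_subset by auto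
    have "insert i (insert j I) - {j} = insert i I" using I False by auto
    moreover have "weight q j (insert i (insert j I)) = (if j < i then - inverse q else 1) * weight q j I"
      using I False by (simp add: weight_insert weight_insert_self)
    moreover have "weight q i (insert i (insert j I)) = (if i < j then - inverse q else 1) * weight q i I"
      using I False by (simp add: weight_insert weight_insert_self)
    moreover have "q powi sgn (int i - int j) = (if i < j then inverse q else q)"
      using False by (auto simp: sgn_if power_int_minus)
    ultimately show "q powi sgn (int i - int j) *\<^sub>C f (insert j I) =
        - ((weight q j I / weight q i I) *\<^sub>C wedge q M (insert j I) (insert i I))"
      using q False by (auto simp: f_def scaleC.scale_minus_left[symmetric] simp del: scaleC.scale_minus_left)
  qed
  finally show ?thesis
    using False by (simp add: sum_q_cofactor_mult[OF q M sq i j] sum_negf)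
qed

lemma q_power_carrier: "q_power q M m \<in> carrier_mat (dim_row M) (dim_col M)"
  if "dim_col M = dim_row M"
  using that by (induction m) (auto simp: q_times_def)

text \<open>
  A Cayley-Hamilton expansion. By the definition of the \<open>q\<close>-powers the left side satisfies a recursion
  in \<open>m\<close> whose terms carry \<open>q powi sgn (int l - int i)\<close>. This power cancels the one in front of the
  cofactor for \<open>(i, l)\<close>, and what remains is the recursion \<open>q_cofactor_Suc\<close>.
\<close>

lemma q_cayley_hamilton:
  assumes q: "q \<noteq> 0" and M: "q_manin q M" and sq: "dim_col M = dim_row M"
    and i: "i < dim_row M" and j: "j < dim_row M"
  shows "(\<Sum>k\<le>m. (- 1) ^ (m - k) *\<^sub>C (q_elem q M k * q_power q M (m - k) $$ (i,j))) =
    q powi sgn (int i - int j) *\<^sub>C q_cofactor q M m i j"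
  using j
proof (induction m arbitrary: j)
  case 0
  then show ?case using i by (auto simp: q_elem_0 q_cofactor_0[OF q] scaleC_one)
next
  case (Suc m)
  have power: "q_power q M (Suc r) $$ (i,j) =
    (\<Sum>l<dim_row M. q powi sgn (int l - int i) *\<^sub>C (q_power q M r $$ (i,l) * M $$ (l,j)))" for r
    using q_power_carrier[OF sq, of q r] i Suc.prems sq by (simp add: q_times_def)
  have "(\<Sum>k\<le>m. (- 1) ^ (Suc m - k) *\<^sub>C (q_elem q M k * q_power q M (Suc m - k) $$ (i,j))) =
    (\<Sum>k\<le>m. - (\<Sum>l<dim_row M. q powi sgn (int l - int i) *\<^sub>C
       (((- 1) ^ (m - k) *\<^sub>C (q_elem q M k * q_power q M (m - k) $$ (i,l))) * M $$ (l,j))))"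
  proof (intro sum.cong refl)
    fix k assume "k \<in> {..m}"
    then have "Suc m - k = Suc (m - k)" by auto
    then show "(- 1) ^ (Suc m - k) *\<^sub>C (q_elem q M k * q_power q M (Suc m - k) $$ (i,j)) =
      - (\<Sum>l<dim_row M. q powi sgn (int l - int i) *\<^sub>C
       (((- 1) ^ (m - k) *\<^sub>C (q_elem q M k * q_power q M (m - k) $$ (i,l))) * M $$ (l,j)))"
      by (simp only: power)
        (simp add: sum_distrib_left scaleC.scale_sum_right mult_scaleC_left mult_scaleC_right
          scaleC.scale_minus_left mult.assoc mult.commute sum_negf)
  qed
  also have "\<dots> = - (\<Sum>l<dim_row M. q powi sgn (int l - int i) *\<^sub>C
      ((\<Sum>k\<le>m. (- 1) ^ (m - k) *\<^sub>C (q_elem q M k * q_power q M (m - k) $$ (i,l))) * M $$ (l,j)))"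
    unfolding sum_negf sum_distrib_right scaleC.scale_sum_right by (subst sum.swap) (rule refl)
  also have "\<dots> = - (\<Sum>l<dim_row M. q_cofactor q M m i l * M $$ (l,j))"
  proof -
    have "q powi sgn (int l - int i) * q powi sgn (int i - int l) = 1" for l
      using q by (auto simp: sgn_if power_int_minus)
    then show ?thesis using Suc.IH by (simp add: mult_scaleC_left scaleC_one)
  qed
  finally show ?case
    unfolding q_cofactor_Suc[OF q M sq i Suc.prems]
    using i Suc.prems by (simp add: scaleC_one)
qed

text \<open>
  A principal minor with index set \<open>I\<close> of size \<open>m\<close> occurs once for every \<open>i\<close> outside \<open>I\<close>. The number
  \<open>dim_row M - m\<close> of these \<open>i\<close> is written as a difference in \<open>complex\<close>, which is meaningful for
  \<open>m > dim_row M\<close> as well; both sides then vanish.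
\<close>

lemma sum_q_cofactor_diag:
  assumes q: "q \<noteq> 0" and sq: "dim_col M = dim_row M"
  shows "(\<Sum>i<dim_row M. q_cofactor q M m i i) = of_nat (dim_row M) *\<^sub>C q_elem q M m - of_nat m *\<^sub>C q_elem q M m"
proof -
  let ?n = "dim_row M" and ?S = "{I. I \<subseteq> {..<dim_row M} \<and> card I = m}"
  have const: "(\<Sum>i\<in>A. x) = of_nat (card A) *\<^sub>C x" if "finite A" for A :: "nat set" and x :: 'a
    using that by (induction A) (simp_all add: scaleC.scale_left_distrib scaleC_one)
  have "(\<Sum>i<?n. q_cofactor q M m i i) = (\<Sum>i<?n. \<Sum>I\<in>{I\<in>?S. i \<notin> I}. wedge q M I I)"
    unfolding q_cofactor_diag[OF q] by (simp add: conj_assoc)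
  also have "\<dots> = (\<Sum>I\<in>?S. \<Sum>i\<in>{i\<in>{..<?n}. i \<notin> I}. wedge q M I I)"
    by (rule sum.swap_restrict[OF finite_lessThan finite_subsets_lessThan])
  also have "\<dots> = (\<Sum>I\<in>?S. of_nat ?n *\<^sub>C wedge q M I I - of_nat m *\<^sub>C wedge q M I I)"
  proof (intro sum.cong refl)
    fix I assume "I \<in> ?S"
    then have I: "I \<subseteq> {..<?n}" "card I = m" by auto
    then have "card {i\<in>{..<?n}. i \<notin> I} = ?n - m" "m \<le> ?n"
      using card_Diff_subset[of I "{..<?n}"] card_mono[OF _ I(1)] finite_subset[OF I(1)]
      by (auto simp: set_diff_eq)
    then show "(\<Sum>i\<in>{i\<in>{..<?n}. i \<notin> I}. wedge q M I I) =
        of_nat ?n *\<^sub>C wedge q M I I - of_nat m *\<^sub>C wedge q M I I"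
      by (subst const) (simp_all add: of_nat_diff scaleC.scale_left_diff_distrib)
  qed
  finally show ?thesis
    by (simp add: q_elem_eq_sum_wedge[OF sq] sum_subtractf scaleC.scale_sum_right)
qed

section \<open>The Newton identities\<close>

theorem theorem5p7:
  fixes q :: complex and n m :: nat and M :: "'a::complex_algebra mat"
  assumes "q \<noteq> 0"
    and "M \<in> carrier_mat n n"
    and "q_manin q M"
  shows "of_nat m *\<^sub>C q_elem q M m =
    (\<Sum>k<m. (- 1) ^ (m + k + 1) *\<^sub>C (q_elem q M k * tr (q_power q M (m - k))))"
proof -
  have dim: "dim_row M = n" and sq: "dim_col M = dim_row M" using assms(2) by auto
  have tr: "tr (q_power q M r) = (\<Sum>i<n. q_power q M r $$ (i,i))" for r
    using q_power_carrier[OF sq, of q r] dim by (simp add: tr_def)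
  have "tr (q_power q M 0) = of_nat n *\<^sub>C 1"
  proof -
    have "(\<Sum>i<k. 1) = of_nat k *\<^sub>C (1::'a)" for k
      by (induction k) (simp_all add: scaleC.scale_left_distrib scaleC_one add.commute)
    then show ?thesis using dim by (simp add: tr_def)
  qed
  then have top: "q_elem q M m * tr (q_power q M 0) = of_nat n *\<^sub>C q_elem q M m"
    by (simp add: mult_scaleC_right)
  have "(\<Sum>k\<le>m. (- 1) ^ (m - k) *\<^sub>C (q_elem q M k * tr (q_power q M (m - k)))) =
    (\<Sum>i<n. \<Sum>k\<le>m. (- 1) ^ (m - k) *\<^sub>C (q_elem q M k * q_power q M (m - k) $$ (i,i)))"
    unfolding tr sum_distrib_left scaleC.scale_sum_right by (rule sum.swap)
  also have "\<dots> = (\<Sum>i<n. q_cofactor q M m i i)"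
    using q_cayley_hamilton[OF assms(1,3) sq] dim by (simp add: scaleC_one)
  also have "\<dots> = of_nat n *\<^sub>C q_elem q M m - of_nat m *\<^sub>C q_elem q M m"
    using sum_q_cofactor_diag[OF assms(1) sq] dim by simp
  \<comment> \<open>The term \<open>k = m\<close> of the sum is \<open>of_nat n *\<^sub>C q_elem q M m\<close> and cancels.\<close>
  finally have "of_nat m *\<^sub>C q_elem q M m =
      - (\<Sum>k<m. (- 1) ^ (m - k) *\<^sub>C (q_elem q M k * tr (q_power q M (m - k))))"
    using top by (simp add: lessThan_Suc_atMost[symmetric] scaleC_one eq_neg_iff_add_eq_0 algebra_simps del: q_power.simps)
  also have "\<dots> = (\<Sum>k<m. (- 1) ^ (m + k + 1) *\<^sub>C (q_elem q M k * tr (q_power q M (m - k))))"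
    unfolding sum_negf[symmetric]
  proof (intro sum.cong refl)
    fix k assume "k \<in> {..<m}"
    then have "m + k + 1 = Suc (m - k) + 2 * k" by auto
    then have "(- 1) ^ (m + k + 1) = - ((- 1) ^ (m - k) :: complex)"
      by (simp only: power_add power_mult) simp
    then show "- ((- 1) ^ (m - k) *\<^sub>C (q_elem q M k * tr (q_power q M (m - k)))) =
        (- 1) ^ (m + k + 1) *\<^sub>C (q_elem q M k * tr (q_power q M (m - k)))"
      by (simp add: scaleC.scale_minus_left)
  qed
  finally show ?thesis .
qed

end
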